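(* Let $f,g:U\to\mathbb{R}_n$ be slice monogenic on an axially symmetric slice domain $U\subseteq\mathbb{R}^{n+1}$, let $I=I_1\in\mathbb{S}$, and write $f_I=\sum_A F_AI_A$, $g_I=\sum_B G_BI_B$ on $U\cap\mathbb{C}_I$ with $F_A,G_B:U\cap\mathbb{C}_I\to\mathbb{C}_I$ holomorphic, where $A,B$ range over the subsets of $\{2,\dots,n\}$. Then the definition $$\begin{aligned} f_I*g_I(z)&=\sum_{|A|\text{ even}}(-1)^{\frac{|A|}{2}}F_A(z)G_A(z)+\sum_{|A|\text{ odd}}(-1)^{\frac{|A|+1}{2}}F_A(z)\hat G_A(z)\\ &\quad+\sum_{|A|\text{ even},\,B\ne A}F_A(z)G_B(z)I_AI_B+\sum_{|A|\text{ odd},\,B\neq A}F_A(z)\hat G_B(z)I_AI_B\end{aligned}$$ is equivalent to $$f_I*g_I(z)=\sum_{C\subseteq\{2,\dots,n\}}H_C(z)\,I_C,\qquad H_C(z)=\sum_{A,B\subseteq\{2,\dots,n\},\ A\triangle B=C}(-1)^{\sigma(A,B)}F_A(z)\,\widetilde G_B(z),$$ with $$\sigma(A,B)=|A\cap B|+|\{(a,b)\in A\times B:a>b\}|,\qquad \widetilde G_B(z)=\begin{cases}G_B(z)&\text{if }|A|\text{ is even},\\ \hat G_B(z)=\overline{G_B(\bar z)}&\text{if }|A|\text{ is odd};\end{cases}$$ that is, the two right-hand sides coincide for all $z\in U\cap\mathbb{C}_I$.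
   Context: $\mathbb{R}_n$ is the real unital associative algebra generated by $I_1,\dots,I_n$ with $I_iI_j+I_jI_i=-2\delta_{ij}$. For $A=\{a_1<\dots<a_k\}\subseteq\{2,\dots,n\}$, $I_A=I_{a_1}\cdots I_{a_k}$, $I_\emptyset=1$. $(x_0,\dots,x_n)\in\mathbb{R}^{n+1}$ is identified with $x_0+x_1I_1+\dots+x_nI_n$; $\mathbb{S}$ is the set of unit 1-vectors ($I^2=-1$ for $I\in\mathbb{S}$), $\mathbb{C}_I=\mathbb{R}+I\mathbb{R}$. Given $I\in\mathbb{S}$, set $I_1=I$ and complete to unit 1-vectors $I_1,\dots,I_n$ generating $\mathbb{R}_n$ and satisfying the same relations. A real-differentiable $f:U\to\mathbb{R}_n$ is slice monogenic if for all $I\in\mathbb{S}$, $f_I=f|_{U\cap\mathbb{C}_I}$ satisfies $\frac12(\partial_u+I\partial_v)f_I(u+Iv)=0$. A slice domain is a domain $U$ meeting $\mathbb{R}$ with $U\cap\mathbb{C}_I$ a domain in $\mathbb{C}_I$ for all $I\in\mathbb{S}$; it is axially symmetric if $u+Iv\in U$ implies $u+Jv\in U$ for all $J\in\mathbb{S}$. Every slice monogenic $f$ has a splitting $f_I=\sum_{A\subseteq\{2,\dots,n\}}F_AI_A$ with $F_A:U\cap\mathbb{C}_I\to\mathbb{C}_I$ holomorphic. $A\triangle B=(A\cup B)\setminus(A\cap B)$ and $\hat G(z)=\overline{G(\bar z)}$. *)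

theory Defs
  imports "HOL-Analysis.Analysis"
begin

section \<open>The Clifford algebra\<close>

text \<open>
  An element is the family of its coefficients with respect to the products
  \<open>e\<^sub>A = e\<^sub>a\<^sub>1 \<cdots> e\<^sub>a\<^sub>k\<close>, where \<open>A = {a\<^sub>1 < \<cdots> < a\<^sub>k}\<close> ranges over the subsets of \<open>{1..n}\<close>.
  The number \<open>n\<close> of generators is the cardinality of the index type.
  That this is the algebra presented by the generators \<open>e\<^sub>i\<close> and the relations
  \<open>e\<^sub>i e\<^sub>j + e\<^sub>j e\<^sub>i = -2 \<delta>\<^sub>i\<^sub>j\<close> is lemma \<open>clifford_universal\<close> below.
\<close>

typedef (overloaded) ('n::finite) clifford =
  "{x :: nat set \<Rightarrow> real. \<forall>A. \<not> A \<subseteq> {1..CARD('n)} \<longrightarrow> x A = 0}"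
  morphisms coef Abs_clifford
  by (rule exI[of _ "\<lambda>_. 0"]) simp

setup_lifting type_definition_clifford

lemma coef_outside: "\<not> A \<subseteq> {1..CARD('n)} \<Longrightarrow> coef (x :: 'n::finite clifford) A = 0"
  by transfer simp

lemma clifford_eqI:
  assumes "\<And>A. A \<subseteq> {1..CARD('n)} \<Longrightarrow> coef x A = coef y A"
  shows "x = (y :: 'n::finite clifford)"
  using assms coef_outside by (metis (full_types) coef_inject ext)

text \<open>
  \<open>e\<^sub>A e\<^sub>B = \<plusminus> e\<^sub>A\<^sub>\<triangle>\<^sub>B\<close>: each factor of \<open>e\<^sub>B\<close> is moved to the left past the larger factors
  of \<open>e\<^sub>A\<close>, giving a sign each time, and a further sign comes from \<open>e\<^sub>b\<^sup>2 = -1\<close>.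
\<close>

definition clifford_sign :: "nat set \<Rightarrow> nat set \<Rightarrow> real" where
  "clifford_sign A B = (\<Prod>a\<in>A. \<Prod>b\<in>B. if b \<le> a then -1 else 1)"

instantiation clifford :: (finite) real_vector
begin
lift_definition zero_clifford :: "'a clifford" is "\<lambda>_. 0" by simp
lift_definition plus_clifford :: "'a clifford \<Rightarrow> 'a clifford \<Rightarrow> 'a clifford"
  is "\<lambda>x y A. x A + y A" by simp
lift_definition minus_clifford :: "'a clifford \<Rightarrow> 'a clifford \<Rightarrow> 'a clifford"
  is "\<lambda>x y A. x A - y A" by simp
lift_definition uminus_clifford :: "'a clifford \<Rightarrow> 'a clifford"
  is "\<lambda>x A. - x A" by simp
lift_definition scaleR_clifford :: "real \<Rightarrow> 'a clifford \<Rightarrow> 'a clifford"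
  is "\<lambda>r x A. r * x A" by simp
instance
  by standard (transfer; simp add: fun_eq_iff algebra_simps)+
end

lemma sym_diff_assoc: "sym_diff (sym_diff A B) C = sym_diff A (sym_diff B C)"
  by blast

lemma prod_sym_diff:
  fixes h :: "'a \<Rightarrow> real"
  assumes "finite A" "finite B" "\<And>x. h x * h x = 1"
  shows "prod h (sym_diff A B) = prod h A * prod h B"
proof -
  have 1: "prod h A = prod h (A - B) * prod h (A \<inter> B)"
    using assms by (metis prod.Int_Diff mult.commute)
  have 2: "prod h B = prod h (B - A) * prod h (A \<inter> B)"
    using assms by (metis prod.Int_Diff mult.commute inf_commute)
  have 3: "prod h (A \<inter> B) * prod h (A \<inter> B) = 1"
    by (simp flip: prod.distrib add: assms)
  have "prod h (sym_diff A B) = prod h (A - B) * prod h (B - A)"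
    by (rule prod.union_disjoint) (use assms in auto)
  also have "\<dots> = prod h (A - B) * prod h (B - A) * (prod h (A \<inter> B) * prod h (A \<inter> B))"
    by (simp add: 3)
  finally show ?thesis by (simp add: 1 2 mult_ac)
qed

lemma clifford_sign_empty [simp]: "clifford_sign {} B = 1" "clifford_sign A {} = 1"
  by (simp_all add: clifford_sign_def)

lemma clifford_sign_sym_diff_left:
  assumes "finite A" "finite B"
  shows "clifford_sign (sym_diff A B) C = clifford_sign A C * clifford_sign B C"
  unfolding clifford_sign_def by (rule prod_sym_diff) (use assms in \<open>auto simp flip: prod.distrib
      intro!: prod.neutral\<close>)

lemma clifford_sign_sym_diff_right:
  assumes "finite B" "finite C"
  shows "clifford_sign A (sym_diff B C) = clifford_sign A B * clifford_sign A C"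
proof -
  have "(\<Prod>b\<in>sym_diff B C. if b \<le> a then -1 else 1 :: real) =
      (\<Prod>b\<in>B. if b \<le> a then -1 else 1) * (\<Prod>b\<in>C. if b \<le> a then -1 else 1)" for a
    by (rule prod_sym_diff) (use assms in auto)
  then show ?thesis
    unfolding clifford_sign_def by (simp only: prod.distrib)
qed

lemma clifford_sign_cocycle:
  assumes "finite A" "finite B" "finite C"
  shows "clifford_sign A B * clifford_sign (sym_diff A B) C =
    clifford_sign B C * clifford_sign A (sym_diff B C)"
  by (simp add: assms clifford_sign_sym_diff_left clifford_sign_sym_diff_right)

lemma sum_pairs_sym_diff:
  fixes h :: "nat set \<Rightarrow> nat set \<Rightarrow> 'a::comm_monoid_add"
  assumes "C \<subseteq> N"
  shows "(\<Sum>(A, B)\<in>{(A, B). A \<subseteq> N \<and> B \<subseteq> N \<and> sym_diff A B = C}. h A B) =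
    (\<Sum>A\<in>Pow N. h A (sym_diff A C))"
proof (rule sum.reindex_bij_witness[of _ "\<lambda>A. (A, sym_diff A C)" fst])
  fix p assume p: "p \<in> {(A, B). A \<subseteq> N \<and> B \<subseteq> N \<and> sym_diff A B = C}"
  then obtain A B where AB: "p = (A, B)" "A \<subseteq> N" "C = sym_diff A B" by auto
  have "sym_diff A C = B" unfolding AB by blast
  then show "(fst p, sym_diff (fst p) C) = p" "fst p \<in> Pow N"
    "h (fst p) (sym_diff (fst p) C) = (case p of (A, B) \<Rightarrow> h A B)"
    using AB by simp_all
next
  fix A assume A: "A \<in> Pow N"
  have "sym_diff A (sym_diff A C) = C" by blast
  then show "fst (A, sym_diff A C) = A"
    "(A, sym_diff A C) \<in> {(A, B). A \<subseteq> N \<and> B \<subseteq> N \<and> sym_diff A B = C}"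
    using A assms by auto
qed

instantiation clifford :: (finite) real_algebra_1
begin

lift_definition one_clifford :: "'a clifford" is "\<lambda>A. if A = {} then 1 else 0" by auto

lift_definition times_clifford :: "'a clifford \<Rightarrow> 'a clifford \<Rightarrow> 'a clifford"
  is "\<lambda>x y C. \<Sum>(A, B)\<in>{(A, B). A \<subseteq> {1..CARD('a)} \<and> B \<subseteq> {1..CARD('a)} \<and> sym_diff A B = C}.
    clifford_sign A B * x A * y B"
  by (rule sum.neutral) auto

lemma coef_times:
  "coef (x * y :: 'a clifford) C =
    (\<Sum>A\<in>Pow {1..CARD('a)}. clifford_sign A (sym_diff A C) * coef x A * coef y (sym_diff A C))"
proof (cases "C \<subseteq> {1..CARD('a)}")
  case True
  show ?thesis
    using sum_pairs_sym_diff[OF True] by (simp add: times_clifford.rep_eq)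
next
  case False
  then have "coef y (sym_diff A C) = 0" if "A \<in> Pow {1..CARD('a)}" for A
    using that by (intro coef_outside) blast
  then show ?thesis using False by (simp add: coef_outside)
qed

instance
proof
  let ?N = "{1..CARD('a)}"
  fix x y z :: "'a clifford" and r :: real
  show "x * y * z = x * (y * z)"
  proof (rule clifford_eqI)
    fix D assume D: "D \<subseteq> ?N"
    have fin: "finite A" if "A \<subseteq> ?N" for A using that finite_subset by blast
    have "coef (x * y * z) D = (\<Sum>C\<in>Pow ?N. \<Sum>A\<in>Pow ?N.
        clifford_sign A (sym_diff A C) * clifford_sign C (sym_diff C D) *
        coef x A * coef y (sym_diff A C) * coef z (sym_diff C D))"
      by (simp only: coef_times sum_distrib_left sum_distrib_right mult_ac)
    also have "\<dots> = (\<Sum>A\<in>Pow ?N. \<Sum>C\<in>Pow ?N.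
        clifford_sign A (sym_diff A C) * clifford_sign C (sym_diff C D) *
        coef x A * coef y (sym_diff A C) * coef z (sym_diff C D))"
      by (rule sum.swap)
    also have "\<dots> = (\<Sum>A\<in>Pow ?N. \<Sum>B\<in>Pow ?N.
        clifford_sign A (sym_diff A D) * clifford_sign B (sym_diff B (sym_diff A D)) *
        coef x A * coef y B * coef z (sym_diff B (sym_diff A D)))"
    proof (rule sum.cong[OF refl])
      fix A assume A: "A \<in> Pow ?N"
      show "(\<Sum>C\<in>Pow ?N.
          clifford_sign A (sym_diff A C) * clifford_sign C (sym_diff C D) *
          coef x A * coef y (sym_diff A C) * coef z (sym_diff C D)) =
        (\<Sum>B\<in>Pow ?N.
          clifford_sign A (sym_diff A D) * clifford_sign B (sym_diff B (sym_diff A D)) *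
          coef x A * coef y B * coef z (sym_diff B (sym_diff A D)))"
      proof (rule sum.reindex_bij_witness[of _ "sym_diff A" "sym_diff A"])
        fix C assume C: "C \<in> Pow ?N"
        define B where "B = sym_diff A C"
        have BC: "sym_diff A B = C" unfolding B_def by blast
        have E: "sym_diff B (sym_diff A D) = sym_diff C D" unfolding B_def by blast
        have F: "sym_diff B (sym_diff C D) = sym_diff A D" unfolding B_def by blast
        have fins: "finite A" "finite B" "finite (sym_diff C D)"
          using A C D fin by (auto simp: B_def)
        have "clifford_sign A B * clifford_sign C (sym_diff C D) =
            clifford_sign B (sym_diff C D) * clifford_sign A (sym_diff A D)"
          using clifford_sign_cocycle[OF fins] by (simp only: BC F)
        then show "clifford_sign A (sym_diff A D) *
            clifford_sign (sym_diff A C) (sym_diff (sym_diff A C) (sym_diff A D)) *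
            coef x A * coef y (sym_diff A C) * coef z (sym_diff (sym_diff A C) (sym_diff A D)) =
          clifford_sign A (sym_diff A C) * clifford_sign C (sym_diff C D) *
            coef x A * coef y (sym_diff A C) * coef z (sym_diff C D)"
          unfolding B_def[symmetric] E by (simp add: mult_ac)
      qed (use A in auto)
    qed
    also have "\<dots> = coef (x * (y * z)) D"
      by (simp only: coef_times sum_distrib_left mult_ac)
    finally show "coef (x * y * z) D = coef (x * (y * z)) D" .
  qed
  show "(x + y) * z = x * z + y * z"
    by (rule clifford_eqI) (simp add: coef_times plus_clifford.rep_eq sum.distrib ring_distribs)
  show "x * (y + z) = x * y + x * z"
    by (rule clifford_eqI) (simp add: coef_times plus_clifford.rep_eq sum.distrib ring_distribs)
  show "r *\<^sub>R x * y = r *\<^sub>R (x * y)"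
    by (rule clifford_eqI) (simp add: coef_times scaleR_clifford.rep_eq sum_distrib_left mult_ac)
  show "x * r *\<^sub>R y = r *\<^sub>R (x * y)"
    by (rule clifford_eqI) (simp add: coef_times scaleR_clifford.rep_eq sum_distrib_left mult_ac)
  show "1 * x = x"
  proof (rule clifford_eqI)
    fix D assume D: "D \<subseteq> ?N"
    have "coef (1 * x) D = (\<Sum>A\<in>Pow ?N. if A = {} then coef x D else 0)"
      unfolding coef_times by (rule sum.cong) (auto simp: one_clifford.rep_eq)
    then show "coef (1 * x) D = coef x D" by (simp add: sum.delta)
  qed
  show "x * 1 = x"
  proof (rule clifford_eqI)
    fix D assume D: "D \<subseteq> ?N"
    have "coef (x * 1) D = (\<Sum>A\<in>Pow ?N. if A = D then coef x D else 0)"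
      unfolding coef_times
      by (rule sum.cong[OF refl]) (auto simp: one_clifford.rep_eq)
    then show "coef (x * 1) D = coef x D" using D by (simp add: sum.delta)
  qed
  show "(0 :: 'a clifford) \<noteq> 1"
    by (metis one_clifford.rep_eq zero_clifford.rep_eq zero_neq_one)
qed

end

text \<open>The Euclidean structure of \<open>\<real>\<^bsup>2^n\<^esup>\<close>.\<close>

instantiation clifford :: (finite) real_inner
begin
definition inner_clifford :: "'a clifford \<Rightarrow> 'a clifford \<Rightarrow> real" where
  "inner_clifford x y = (\<Sum>A\<in>Pow {1..CARD('a)}. coef x A * coef y A)"
definition norm_clifford :: "'a clifford \<Rightarrow> real" where
  "norm_clifford x = sqrt (x \<bullet> x)"
definition dist_clifford :: "'a clifford \<Rightarrow> 'a clifford \<Rightarrow> real" where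
  "dist_clifford x y = norm (x - y)"
definition sgn_clifford :: "'a clifford \<Rightarrow> 'a clifford" where
  "sgn_clifford x = x /\<^sub>R norm x"
definition uniformity_clifford :: "('a clifford \<times> 'a clifford) filter" where
  "uniformity_clifford = (INF e\<in>{0<..}. principal {(x, y). dist x y < e})"
definition open_clifford :: "'a clifford set \<Rightarrow> bool" where
  "open_clifford U = (\<forall>x\<in>U. \<forall>\<^sub>F (x', y) in uniformity. x' = x \<longrightarrow> y \<in> U)"
instance
proof
  fix x y z :: "'a clifford" and r :: real
  show "x \<bullet> y = y \<bullet> x" by (simp add: inner_clifford_def mult.commute)
  show "(x + y) \<bullet> z = x \<bullet> z + y \<bullet> z"
    by (simp add: inner_clifford_def plus_clifford.rep_eq sum.distrib ring_distribs)
  show "r *\<^sub>R x \<bullet> y = r * (x \<bullet> y)"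
    by (simp add: inner_clifford_def scaleR_clifford.rep_eq sum_distrib_left mult_ac)
  show "0 \<le> x \<bullet> x" by (simp add: inner_clifford_def sum_nonneg)
  show "x \<bullet> x = 0 \<longleftrightarrow> x = 0"
  proof
    assume "x \<bullet> x = 0"
    then have "coef x A = 0" if "A \<subseteq> {1..CARD('a)}" for A
      using that by (simp add: inner_clifford_def sum_nonneg_eq_0_iff)
    then show "x = 0" by (intro clifford_eqI) (simp add: zero_clifford.rep_eq)
  qed (simp add: inner_clifford_def zero_clifford.rep_eq)
qed (rule dist_clifford_def sgn_clifford_def uniformity_clifford_def open_clifford_def
       norm_clifford_def)+
end

lift_definition gen :: "nat \<Rightarrow> 'n::finite clifford" is
  "\<lambda>i A. if i \<in> {1..CARD('n)} \<and> A = {i} then 1 else 0" by auto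

definition clifford_relations :: "nat \<Rightarrow> (nat \<Rightarrow> 'a::real_algebra_1) \<Rightarrow> bool" where
  "clifford_relations n v \<longleftrightarrow>
    (\<forall>i\<in>{1..n}. \<forall>j\<in>{1..n}. v i * v j + v j * v i = (if i = j then -2 else 0))"

definition blade :: "(nat \<Rightarrow> 'a::monoid_mult) \<Rightarrow> nat set \<Rightarrow> 'a" where
  "blade v A = prod_list (map v (sorted_list_of_set A))"

subsection \<open>Generators and relations\<close>

lemma blade_empty [simp]: "blade v {} = 1"
  by (simp add: blade_def)

lemma blade_insert_min:
  assumes "finite A" "\<forall>a\<in>A. b < a"
  shows "blade v (insert b A) = v b * blade v A"
proof -
  have "b \<notin> A" using assms by auto
  then have "sorted_list_of_set (insert b A) = insort b (sorted_list_of_set A)"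
    using assms by simp
  also have "\<dots> = b # sorted_list_of_set A"
    using assms by (intro insort_is_Cons) (auto intro: less_imp_le)
  finally show ?thesis by (simp add: blade_def)
qed

lemma gen_mult_blade:
  assumes "clifford_relations n v" "finite A" "A \<subseteq> {1..n}" "i \<in> {1..n}"
  shows "v i * blade v A = clifford_sign {i} A *\<^sub>R blade v (sym_diff {i} A)"
  using assms(2,3)
proof (induction A rule: finite_linorder_min_induct)
  case empty
  show ?case by (simp add: blade_def)
next
  case (insert b A)
  note IH = insert.IH[OF order_trans[OF subset_insertI insert.prems]]
  have b: "b \<in> {1..n}" "b \<notin> A" using insert by auto
  have blade: "blade v (insert b A) = v b * blade v A"
    using insert by (intro blade_insert_min) auto
  have sign: "clifford_sign {i} (insert b A) = (if b \<le> i then -1 else 1) * clifford_sign {i} A"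
    using insert.hyps b by (simp add: clifford_sign_def)
  consider "i < b" | "i = b" | "b < i" by linarith
  then show ?case
  proof cases
    case 1
    then have less: "\<forall>a\<in>insert b A. i < a" using insert.hyps by auto
    then have "clifford_sign {i} (insert b A) = 1"
      by (auto simp: clifford_sign_def intro!: prod.neutral)
    moreover have "sym_diff {i} (insert b A) = insert i (insert b A)" using less by blast
    ultimately show ?thesis using blade_insert_min[of "insert b A" i v] less insert.hyps by simp
  next
    case 2
    have "v b * v b + v b * v b = -2" using assms(1) b by (auto simp: clifford_relations_def)
    then have "2 *\<^sub>R (v b * v b) = 2 *\<^sub>R (-1)" by (simp add: scaleR_2)
    then have sq: "v b * v b = -1" by (subst (asm) scaleR_cancel_left) simp
    have "clifford_sign {i} A = 1"
      using insert.hyps 2 by (auto simp: clifford_sign_def intro!: prod.neutral)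
    moreover have "sym_diff {i} (insert b A) = A" using 2 b by blast
    ultimately show ?thesis using sign 2 sq by (simp add: blade mult.assoc[symmetric])
  next
    case 3
    have "v i * v b + v b * v i = 0"
      using assms(1,4) b 3 by (auto simp: clifford_relations_def)
    then have anti: "v i * v b = - (v b * v i)" by (rule eq_neg_iff_add_eq_0[THEN iffD2])
    have eq: "sym_diff {i} (insert b A) = insert b (sym_diff {i} A)" using 3 b by blast
    have bl: "blade v (insert b (sym_diff {i} A)) = v b * blade v (sym_diff {i} A)"
      using insert.hyps 3 by (intro blade_insert_min) auto
    have "v i * blade v (insert b A) = - (v b * (v i * blade v A))"
      by (simp add: blade mult.assoc[symmetric] anti)
    also have "\<dots> = - clifford_sign {i} A *\<^sub>R (v b * blade v (sym_diff {i} A))"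
      by (simp add: IH)
    finally show ?thesis unfolding eq bl sign using 3 by simp
  qed
qed

lemma blade_mult_blade:
  assumes "clifford_relations n v" "A \<subseteq> {1..n}" "B \<subseteq> {1..n}"
  shows "blade v A * blade v B = clifford_sign A B *\<^sub>R blade v (sym_diff A B)"
proof -
  have fB: "finite B" using assms(3) finite_subset by blast
  have "finite A" using assms(2) finite_subset by blast
  then show ?thesis using assms(2)
  proof (induction A rule: finite_linorder_min_induct)
    case (insert b A)
    let ?D = "sym_diff A B"
    have "b \<notin> A" using insert by auto
    have "blade v (insert b A) * blade v B = v b * (blade v A * blade v B)"
      using insert.hyps by (simp add: blade_insert_min mult.assoc)
    also have "\<dots> = clifford_sign A B *\<^sub>R (v b * blade v ?D)"
      using insert by simp
    also have "v b * blade v ?D = clifford_sign {b} ?D *\<^sub>R blade v (sym_diff {b} ?D)"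
      using insert assms fB by (intro gen_mult_blade) auto
    also have "sym_diff {b} ?D = sym_diff (insert b A) B" using \<open>b \<notin> A\<close> by blast
    also have "clifford_sign {b} ?D = clifford_sign {b} A * clifford_sign {b} B"
      using insert fB by (intro clifford_sign_sym_diff_right) auto
    also have "clifford_sign {b} A = 1"
      using insert by (auto simp: clifford_sign_def intro!: prod.neutral)
    finally show ?case using insert.hyps \<open>b \<notin> A\<close> by (simp add: clifford_sign_def mult.commute)
  qed simp
qed

lemma coef_gen:
  "i \<in> {1..CARD('n)} \<Longrightarrow> coef (gen i :: 'n::finite clifford) A = (if A = {i} then 1 else 0)"
  by (simp add: gen.rep_eq)

lemma gen_relations: "clifford_relations CARD('n) (gen :: nat \<Rightarrow> 'n::finite clifford)"
  unfolding clifford_relations_def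
proof (intro ballI)
  let ?N = "{1..CARD('n)}"
  fix i j assume ij: "i \<in> ?N" "j \<in> ?N"
  have prod: "coef (gen i * gen j :: 'n clifford) C =
      (if C = sym_diff {i} {j} then clifford_sign {i} {j} else 0)"
    if "C \<subseteq> ?N" "i \<in> ?N" "j \<in> ?N" for C i j
  proof -
    have "coef (gen i * gen j :: 'n clifford) C = (\<Sum>A\<in>Pow ?N.
        if A = {i} then (if C = sym_diff {i} {j} then clifford_sign {i} {j} else 0) else 0)"
      unfolding coef_times
    proof (rule sum.cong[OF refl])
      fix A assume "A \<in> Pow ?N"
      define S where "S = sym_diff A C"
      have "S = {j} \<longleftrightarrow> C = sym_diff A {j}" unfolding S_def by blast
      then have "clifford_sign A S * coef (gen i :: 'n clifford) A * coef (gen j :: 'n clifford) S =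
        (if A = {i} then (if C = sym_diff {i} {j} then clifford_sign {i} {j} else 0) else 0)"
        using coef_gen[OF that(2), of A] coef_gen[OF that(3), of S] by (cases "S = {j}") auto
      then show "clifford_sign A (sym_diff A C) * coef (gen i :: 'n clifford) A *
          coef (gen j :: 'n clifford) (sym_diff A C) =
        (if A = {i} then (if C = sym_diff {i} {j} then clifford_sign {i} {j} else 0) else 0)"
        unfolding S_def .
    qed
    then show ?thesis using that by (simp add: sum.delta)
  qed
  have num: "coef (-2 :: 'n clifford) C = (if C = {} then -2 else 0)" for C
  proof -
    have "(-2 :: 'n clifford) = of_real (-2)" by simp
    then have "coef (-2 :: 'n clifford) C = coef ((-2) *\<^sub>R (1 :: 'n clifford)) C"
      unfolding of_real_def by (rule arg_cong)
    also have "\<dots> = (if C = {} then -2 else 0)"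
      by (simp only: scaleR_clifford.rep_eq one_clifford.rep_eq) simp
    finally show ?thesis .
  qed
  show "gen i * gen j + gen j * gen i = (if i = j then - 2 else 0 :: 'n clifford)"
  proof (rule clifford_eqI)
    fix C assume C: "C \<subseteq> ?N"
    show "coef (gen i * gen j + gen j * gen i :: 'n clifford) C =
        coef (if i = j then - 2 else 0 :: 'n clifford) C"
      using prod[OF C ij] prod[OF C ij(2,1)] num[of C]
      by (auto simp: plus_clifford.rep_eq zero_clifford.rep_eq clifford_sign_def)
  qed
qed

lemma coef_sum: "coef (\<Sum>i\<in>S. f i) A = (\<Sum>i\<in>S. coef (f i) A)"
  by (induction S rule: infinite_finite_induct)
     (simp_all add: zero_clifford.rep_eq plus_clifford.rep_eq)

lemma coef_blade_gen:
  assumes "A \<subseteq> {1..CARD('n)}"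
  shows "coef (blade gen A :: 'n::finite clifford) C = (if C = A then 1 else 0)"
proof -
  have "finite A" using assms finite_subset by blast
  then show ?thesis using assms
  proof (induction A arbitrary: C rule: finite_linorder_min_induct)
    case empty
    show ?case by (simp add: one_clifford.rep_eq)
  next
    case (insert b A)
    let ?N = "{1..CARD('n)}"
    have b: "b \<notin> A" "b \<in> ?N" using insert by auto
    have A: "A \<subseteq> ?N" using insert by auto
    have sign: "clifford_sign {b} A = 1"
      using insert.hyps by (auto simp: clifford_sign_def intro!: prod.neutral)
    have bl: "blade gen (insert b A) = gen b * (blade gen A :: 'n clifford)"
      using insert.hyps by (intro blade_insert_min) auto
    show ?case
    proof (cases "C \<subseteq> ?N")
      case True
      have "coef (gen b * blade gen A :: 'n clifford) C =
          (\<Sum>B\<in>Pow ?N. if B = {b} then (if C = insert b A then 1 else 0) else 0)"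
        unfolding coef_times
      proof (rule sum.cong[OF refl])
        fix B assume "B \<in> Pow ?N"
        define S where "S = sym_diff B C"
        have "S = A \<longleftrightarrow> C = insert b A" if "B = {b}" unfolding S_def that using b(1) by blast
        then have "clifford_sign B S * coef (gen b :: 'n clifford) B *
            coef (blade gen A :: 'n clifford) S =
          (if B = {b} then (if C = insert b A then 1 else 0) else 0)"
          using coef_gen[OF b(2), of B] sign insert.IH[OF A, of S] by auto
        then show "clifford_sign B (sym_diff B C) * coef (gen b :: 'n clifford) B *
            coef (blade gen A :: 'n clifford) (sym_diff B C) =
          (if B = {b} then (if C = insert b A then 1 else 0) else 0)"
          unfolding S_def .
      qed
      then show ?thesis using b by (simp add: bl sum.delta)
    next
      case False
      then show ?thesis using insert.prems by (auto simp: coef_outside)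
    qed
  qed
qed

lemma clifford_expansion:
  "(x :: 'n::finite clifford) = (\<Sum>A\<in>Pow {1..CARD('n)}. coef x A *\<^sub>R blade gen A)"
proof (rule clifford_eqI)
  fix C assume "C \<subseteq> {1..CARD('n)}"
  have "coef (\<Sum>A\<in>Pow {1..CARD('n)}. coef x A *\<^sub>R (blade gen A :: 'n clifford)) C =
      (\<Sum>A\<in>Pow {1..CARD('n)}. if C = A then coef x C else 0)"
    unfolding coef_sum scaleR_clifford.rep_eq by (rule sum.cong) (auto simp: coef_blade_gen)
  also have "\<dots> = coef x C" using \<open>C \<subseteq> _\<close> by (simp add: sum.delta')
  finally show "coef x C = coef (\<Sum>A\<in>Pow {1..CARD('n)}. coef x A *\<^sub>R (blade gen A :: 'n clifford)) C" ..
qed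

lemma clifford_universal:
  fixes v :: "nat \<Rightarrow> 'b::real_algebra_1"
  assumes v: "clifford_relations CARD('n) v"
  shows "\<exists>!\<phi> :: 'n::finite clifford \<Rightarrow> 'b. linear \<phi> \<and> \<phi> 1 = 1 \<and>
    (\<forall>x y. \<phi> (x * y) = \<phi> x * \<phi> y) \<and> (\<forall>i\<in>{1..CARD('n)}. \<phi> (gen i) = v i)"
proof (rule ex_ex1I)
  let ?N = "{1..CARD('n)}"
  define \<phi> :: "'n clifford \<Rightarrow> 'b" where "\<phi> x = (\<Sum>A\<in>Pow ?N. coef x A *\<^sub>R blade v A)" for x
  have lin: "linear \<phi>"
    by (rule linearI)
       (simp_all add: \<phi>_def plus_clifford.rep_eq scaleR_clifford.rep_eq scaleR_left_distrib
          sum.distrib scaleR_sum_right)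
  have \<phi>_blade: "\<phi> (blade gen A) = blade v A" if "A \<subseteq> ?N" for A
  proof -
    have "\<phi> (blade gen A) = (\<Sum>B\<in>Pow ?N. if B = A then blade v A else 0)"
      unfolding \<phi>_def using that by (intro sum.cong) (auto simp: coef_blade_gen)
    then show ?thesis using that by (simp add: sum.delta)
  qed
  have "\<phi> (x * y) = \<phi> x * \<phi> y" for x y
  proof -
    let ?b = "blade (gen :: nat \<Rightarrow> 'n clifford)"
    have "x * y = (\<Sum>A\<in>Pow ?N. coef x A *\<^sub>R ?b A) * (\<Sum>B\<in>Pow ?N. coef y B *\<^sub>R ?b B)"
      using clifford_expansion by metis
    also have "\<dots> = (\<Sum>A\<in>Pow ?N. \<Sum>B\<in>Pow ?N. (coef x A * coef y B) *\<^sub>R (?b A * ?b B))"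
      by (simp add: sum_product mult.commute)
    finally have "\<phi> (x * y) = (\<Sum>A\<in>Pow ?N. \<Sum>B\<in>Pow ?N. (coef x A * coef y B) *\<^sub>R \<phi> (?b A * ?b B))"
      by (simp add: linear_sum[OF lin] linear_cmul[OF lin])
    also have "\<dots> = (\<Sum>A\<in>Pow ?N. \<Sum>B\<in>Pow ?N. (coef x A * coef y B) *\<^sub>R (blade v A * blade v B))"
    proof (intro sum.cong refl)
      fix A B assume "A \<in> Pow ?N" "B \<in> Pow ?N"
      then have AB: "A \<subseteq> ?N" "B \<subseteq> ?N" by auto
      have "sym_diff A B \<subseteq> ?N" using AB by blast
      then show "(coef x A * coef y B) *\<^sub>R \<phi> (?b A * ?b B) =
          (coef x A * coef y B) *\<^sub>R (blade v A * blade v B)"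
        by (simp only: blade_mult_blade[OF gen_relations AB] blade_mult_blade[OF v AB]
            linear_cmul[OF lin] \<phi>_blade)
    qed
    also have "\<dots> = \<phi> x * \<phi> y"
      by (simp add: \<phi>_def sum_product mult.commute)
    finally show ?thesis .
  qed
  moreover have "\<phi> 1 = 1" using \<phi>_blade[of "{}"] by simp
  moreover have "\<phi> (gen i) = v i" if "i \<in> ?N" for i
    using \<phi>_blade[of "{i}"] that by (simp add: blade_def)
  ultimately show "\<exists>\<phi> :: 'n clifford \<Rightarrow> 'b. linear \<phi> \<and> \<phi> 1 = 1 \<and>
      (\<forall>x y. \<phi> (x * y) = \<phi> x * \<phi> y) \<and> (\<forall>i\<in>?N. \<phi> (gen i) = v i)"
    using lin by blast
next
  let ?N = "{1..CARD('n)}"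
  fix \<phi> \<psi> :: "'n clifford \<Rightarrow> 'b"
  assume \<phi>: "linear \<phi> \<and> \<phi> 1 = 1 \<and> (\<forall>x y. \<phi> (x * y) = \<phi> x * \<phi> y) \<and> (\<forall>i\<in>?N. \<phi> (gen i) = v i)"
    and \<psi>: "linear \<psi> \<and> \<psi> 1 = 1 \<and> (\<forall>x y. \<psi> (x * y) = \<psi> x * \<psi> y) \<and> (\<forall>i\<in>?N. \<psi> (gen i) = v i)"
  have bl: "\<phi> (blade gen A) = \<psi> (blade gen A)" if "A \<subseteq> ?N" for A
  proof -
    have "finite A" using that finite_subset by blast
    then have "set (sorted_list_of_set A) \<subseteq> ?N" using that by simp
    then have "\<phi> (prod_list (map gen xs)) = \<psi> (prod_list (map gen xs))"
      if "xs = sorted_list_of_set A" for xs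
      unfolding that[symmetric] by (induction xs) (use \<phi> \<psi> in auto)
    then show ?thesis by (simp add: blade_def)
  qed
  show "\<phi> = \<psi>"
  proof
    fix x :: "'n clifford"
    have lin: "linear \<phi>" "linear \<psi>" using \<phi> \<psi> by auto
    have "\<phi> (\<Sum>A\<in>Pow ?N. coef x A *\<^sub>R blade gen A) = \<psi> (\<Sum>A\<in>Pow ?N. coef x A *\<^sub>R blade gen A)"
      by (simp add: linear_sum[OF lin(1)] linear_sum[OF lin(2)]
          linear_cmul[OF lin(1)] linear_cmul[OF lin(2)] bl)
    then show "\<phi> x = \<psi> x" using clifford_expansion[of x] by simp
  qed
qed

section \<open>Slice monogenic functions\<close>

definition one_vectors :: "'n::finite clifford set" where
  "one_vectors = {\<Sum>i\<in>{1..CARD('n)}. c i *\<^sub>R gen i | c. True}"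

text \<open>The copy of \<open>\<real>\<^bsup>n+1\<^esup>\<close> in the algebra.\<close>

definition paravectors :: "'n::finite clifford set" where
  "paravectors = {of_real r + v | r v. v \<in> one_vectors}"

definition unit_one_vectors :: "'n::finite clifford set" where
  "unit_one_vectors = {x \<in> one_vectors. norm x = 1}"

text \<open>
  For \<open>I \<in> unit_one_vectors\<close>, the map \<open>slice_emb I\<close> is the identification of \<open>\<complex>\<close> with the
  plane \<open>\<complex>\<^sub>I = \<real> + I\<real>\<close>; points of, and functions between, parts of \<open>\<complex>\<^sub>I\<close> are given by complex
  numbers and complex functions through it.
\<close>

definition slice_emb :: "'n::finite clifford \<Rightarrow> complex \<Rightarrow> 'n clifford" where
  "slice_emb I z = of_real (Re z) + I * of_real (Im z)"

definition slice_plane :: "'n::finite clifford \<Rightarrow> 'n clifford set" where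
  "slice_plane I = range (slice_emb I)"

definition domain_in :: "'a::topological_space set \<Rightarrow> 'a set \<Rightarrow> bool" where
  "domain_in X U \<longleftrightarrow> openin (top_of_set X) U \<and> connected U \<and> U \<noteq> {}"

definition slice_domain :: "'n::finite clifford set \<Rightarrow> bool" where
  "slice_domain U \<longleftrightarrow> domain_in paravectors U \<and> U \<inter> \<real> \<noteq> {} \<and>
    (\<forall>I\<in>unit_one_vectors. domain_in (slice_plane I) (U \<inter> slice_plane I))"

definition axially_symmetric :: "'n::finite clifford set \<Rightarrow> bool" where
  "axially_symmetric U \<longleftrightarrow> (\<forall>I\<in>unit_one_vectors. \<forall>J\<in>unit_one_vectors. \<forall>z.
    slice_emb I z \<in> U \<longrightarrow> slice_emb J z \<in> U)"

definition slice_dbar :: "'n::finite clifford \<Rightarrow> ('n clifford \<Rightarrow> 'n clifford) \<Rightarrow> real \<Rightarrow> real \<Rightarrow> 'n clifford"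
  where "slice_dbar I f u v = (1/2) *\<^sub>R
    (vector_derivative (\<lambda>s. f (slice_emb I (Complex s v))) (at u) +
     I * vector_derivative (\<lambda>t. f (slice_emb I (Complex u t))) (at v))"

text \<open>
  As \<open>U\<close> is going to be open in the paravectors, differentiability within \<open>U\<close> is real
  differentiability as a function of \<open>n + 1\<close> real variables; in particular the partial
  derivatives in \<open>slice_dbar\<close> exist at the points of \<open>U\<close>.
\<close>

definition slice_monogenic :: "'n::finite clifford set \<Rightarrow> ('n clifford \<Rightarrow> 'n clifford) \<Rightarrow> bool" where
  "slice_monogenic U f \<longleftrightarrow> f differentiable_on U \<and>
    (\<forall>I\<in>unit_one_vectors. \<forall>u v. slice_emb I (Complex u v) \<in> U \<longrightarrow> slice_dbar I f u v = 0)"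

inductive_set subalgebra_gen :: "'a::real_algebra_1 set \<Rightarrow> 'a set" for S where
  gen: "x \<in> S \<Longrightarrow> x \<in> subalgebra_gen S"
| one: "1 \<in> subalgebra_gen S"
| add: "x \<in> subalgebra_gen S \<Longrightarrow> y \<in> subalgebra_gen S \<Longrightarrow> x + y \<in> subalgebra_gen S"
| mult: "x \<in> subalgebra_gen S \<Longrightarrow> y \<in> subalgebra_gen S \<Longrightarrow> x * y \<in> subalgebra_gen S"
| scale: "x \<in> subalgebra_gen S \<Longrightarrow> r *\<^sub>R x \<in> subalgebra_gen S"

text \<open>Only the values at \<open>1, \<dots>, n\<close> of a frame are relevant.\<close>

definition clifford_frame :: "(nat \<Rightarrow> 'n::finite clifford) \<Rightarrow> bool" where
  "clifford_frame J \<longleftrightarrow> (\<forall>i\<in>{1..CARD('n)}. J i \<in> unit_one_vectors) \<and>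
    clifford_relations CARD('n) J \<and> subalgebra_gen (J ` {1..CARD('n)}) = UNIV"

lemma subalgebra_gen_sum: "(\<And>i. i \<in> X \<Longrightarrow> h i \<in> subalgebra_gen S) \<Longrightarrow> sum h X \<in> subalgebra_gen S"
proof (induction X rule: infinite_finite_induct)
  case (insert x X)
  then show ?case by (simp add: subalgebra_gen.add)
qed (use subalgebra_gen.scale[OF subalgebra_gen.one, of 0] in simp_all)

lemma clifford_frame_gen: "clifford_frame (gen :: nat \<Rightarrow> 'n::finite clifford)"
proof -
  let ?N = "{1..CARD('n)}" and ?g = "gen :: nat \<Rightarrow> 'n clifford"
  have "?g i \<in> unit_one_vectors" if i: "i \<in> ?N" for i
  proof -
    have "?g i = (\<Sum>j\<in>?N. (if j = i then 1 else 0) *\<^sub>R gen j)"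
      using i by (simp add: if_distrib[of "\<lambda>r. r *\<^sub>R _"] cong: if_cong)
    then have "?g i \<in> one_vectors" unfolding one_vectors_def mem_Collect_eq
      by (intro exI[of _ "\<lambda>j. if j = i then 1 else 0"]) simp
    moreover have "?g i \<bullet> ?g i = (\<Sum>A\<in>Pow ?N. if A = {i} then 1 else 0)"
      unfolding inner_clifford_def by (rule sum.cong) (simp_all add: coef_gen[OF i])
    then have "norm (?g i) = 1" using i by (simp add: norm_clifford_def sum.delta)
    ultimately show ?thesis by (simp add: unit_one_vectors_def)
  qed
  moreover have "x \<in> subalgebra_gen (?g ` ?N)" for x
  proof -
    have "blade ?g A \<in> subalgebra_gen (?g ` ?N)" if "A \<subseteq> ?N" for A
    proof -
      have "prod_list (map ?g xs) \<in> subalgebra_gen (?g ` ?N)" if "set xs \<subseteq> ?N" for xs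
        using that by (induction xs) (auto intro!: subalgebra_gen.one subalgebra_gen.mult intro: subalgebra_gen.gen)
      moreover have "set (sorted_list_of_set A) \<subseteq> ?N"
        using that finite_subset[OF that] by simp
      ultimately show ?thesis by (simp add: blade_def)
    qed
    then have "(\<Sum>A\<in>Pow ?N. coef x A *\<^sub>R blade ?g A) \<in> subalgebra_gen (?g ` ?N)"
      by (intro subalgebra_gen_sum subalgebra_gen.scale) auto
    then show ?thesis using clifford_expansion[of x] by simp
  qed
  ultimately show ?thesis using gen_relations unfolding clifford_frame_def by blast
qed

definition hat :: "(complex \<Rightarrow> complex) \<Rightarrow> complex \<Rightarrow> complex" where
  "hat G z = cnj (G (cnj z))"

definition star_sigma :: "nat set \<Rightarrow> nat set \<Rightarrow> nat" where
  "star_sigma A B = card (A \<inter> B) + card {(a, b). a \<in> A \<and> b \<in> B \<and> a > b}"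

end

theory Submission
  imports Defs
begin

text \<open>
  Since \<open>\<sigma>(A, B)\<close> counts the pairs \<open>(a, b) \<in> A \<times> B\<close> with \<open>b \<le> a\<close>, it gives the sign in
  \<open>I\<^sub>A I\<^sub>B = (-1)\<^bsup>\<sigma>(A,B)\<^esup> I\<^bsub>A\<triangle>B\<^esub>\<close>, so grouping all products \<open>F\<^sub>A G\<^sub>B I\<^sub>A I\<^sub>B\<close> by \<open>A \<triangle> B\<close> gives the
  second formula. The first one separates the diagonal terms, for which
  \<open>\<sigma>(A, A) = |A|(|A| + 1)/2\<close>.
\<close>

text \<open>The pairs with equal entries form a copy of \<open>A \<inter> B\<close>, one for each
  square of a generator; the strict pairs are the transpositions. Together they are the pairs where
  \<open>clifford_sign\<close> has a factor -1.\<close>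

lemma star_sigma_eq_card_le:
  assumes "finite A" "finite B"
  shows "star_sigma A B = card {(a, b). a \<in> A \<and> b \<in> B \<and> b \<le> a}"
proof -
  let ?D = "(\<lambda>a. (a, a)) ` (A \<inter> B)"
  let ?L = "{(a, b). a \<in> A \<and> b \<in> B \<and> a > b}"
  have "{(a, b). a \<in> A \<and> b \<in> B \<and> b \<le> a} = ?D \<union> ?L" by auto
  moreover have "finite ?L"
    by (rule finite_subset[of _ "A \<times> B"]) (use assms in auto)
  moreover have "?D \<inter> ?L = {}" by auto
  moreover have "card ?D = card (A \<inter> B)"
    by (intro card_image inj_onI) simp
  ultimately show ?thesis
    using assms by (simp add: star_sigma_def card_Un_disjoint)
qed

lemma clifford_sign_eq_star_sigma:
  assumes "finite A" "finite B"
  shows "clifford_sign A B = (- 1) ^ star_sigma A B"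
proof -
  have "clifford_sign A B = (\<Prod>p\<in>A \<times> B. if snd p \<le> fst p then - 1 else 1)"
    unfolding clifford_sign_def by (simp add: prod.cartesian_product case_prod_unfold)
  also have "\<dots> = (- 1) ^ card {p \<in> A \<times> B. snd p \<le> fst p}"
    using assms by (simp add: prod.If_cases Int_def)
  also have "{p \<in> A \<times> B. snd p \<le> fst p} = {(a, b). a \<in> A \<and> b \<in> B \<and> b \<le> a}"
    by auto
  finally show ?thesis
    using assms by (simp add: star_sigma_eq_card_le)
qed

text \<open>Triangular numbers arise by adding a new maximum \<open>b\<close>: the only new pairs
  are \<open>(b, y)\<close> with \<open>y\<close> in \<open>insert b A\<close>, one more than
  \<open>card A\<close> of them.\<close>

lemma star_sigma_self:
  assumes "finite A"
  shows "star_sigma A A = card A * (card A + 1) div 2"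
  using assms
proof (induction A rule: finite_linorder_max_induct)
  case empty
  show ?case by (simp add: star_sigma_def)
next
  case (insert b A)
  let ?P = "\<lambda>A. {(x, y). x \<in> A \<and> y \<in> A \<and> y \<le> x}"
  have "?P (insert b A) = ?P A \<union> Pair b ` insert b A"
    using insert.hyps by fastforce
  moreover have "finite (?P A)"
    by (rule finite_subset[of _ "A \<times> A"]) (use insert.hyps in auto)
  moreover have "?P A \<inter> Pair b ` insert b A = {}"
    using insert.hyps by auto
  moreover have "card (Pair b ` insert b A) = card A + 1"
    using insert.hyps by (subst card_image) (auto intro: inj_onI)
  ultimately have "card (?P (insert b A)) = card (?P A) + (card A + 1)"
    using insert.hyps by (simp only: card_Un_disjoint finite_imageI finite_insert)
  then have "star_sigma (insert b A) (insert b A) = star_sigma A A + (card A + 1)"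
    using insert.hyps by (simp only: star_sigma_eq_card_le finite_insert)
  moreover have "card (insert b A) = card A + 1"
    using insert.hyps by (subst card_insert_disjoint) auto
  ultimately show ?case
    using insert.IH by simp
qed

text \<open>Modulo 2 the triangular number of k is half of k or of k + 1, whichever is even: it
  equals m + 2 m^2 for k = 2m and (m + 1) + 2 m (m + 1) for k = 2m + 1.\<close>

lemma minus_one_power_star_sigma_self:
  assumes "finite A"
  shows "(- 1 :: 'a::ring_1) ^ star_sigma A A =
    (if even (card A) then (- 1) ^ (card A div 2) else (- 1) ^ ((card A + 1) div 2))"
proof (cases "even (card A)")
  case True
  then obtain m where m: "card A = 2 * m" by blast
  have "star_sigma A A = m + 2 * (m * m)"
    using m star_sigma_self[OF assms] by (simp add: algebra_simps)
  then show ?thesis using m by (simp add: power_add)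
next
  case False
  then obtain m where m: "card A = 2 * m + 1" by (elim oddE)
  have "card A * (card A + 1) = 2 * ((m + 1) + 2 * (m * (m + 1)))"
    unfolding m by (simp add: algebra_simps)
  then have "star_sigma A A = (m + 1) + 2 * (m * (m + 1))"
    using star_sigma_self[OF assms] by simp
  then have "(- 1 :: 'a) ^ star_sigma A A = (- 1) ^ (m + 1)"
    by (simp only: power_add power_mult) simp
  then show ?thesis using m by simp
qed

lemma blade_mult_blade_star_sigma:
  assumes "clifford_relations n v" "A \<subseteq> {1..n}" "B \<subseteq> {1..n}"
  shows "blade v A * blade v B = (- 1) ^ star_sigma A B * blade v (sym_diff A B)"
proof -
  have "finite A" "finite B" using assms finite_subset by blast+
  then have "clifford_sign A B = (- 1) ^ star_sigma A B"
    by (rule clifford_sign_eq_star_sigma)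
  then show ?thesis
    \<comment> \<open>Fixing the parity turns both the real scalar of
      \<open>blade_mult_blade\<close> and the power in the algebra into a plain sign.\<close>
    by (cases "even (star_sigma A B)") (simp_all add: blade_mult_blade[OF assms])
qed

text \<open>These are the four sums of the first formula. The parity is that of \<open>A\<close>,
  the index of the left factor, because it decides between G_B and its conjugate.\<close>

lemma sum_pairs_split_parity_diagonal:
  fixes h :: "nat set \<Rightarrow> nat set \<Rightarrow> 'a::comm_monoid_add"
  assumes "finite N"
  shows "(\<Sum>(A, B)\<in>Pow N \<times> Pow N. h A B) =
    (\<Sum>A | A \<subseteq> N \<and> even (card A). h A A) + (\<Sum>A | A \<subseteq> N \<and> odd (card A). h A A)
    + (\<Sum>(A, B) | A \<subseteq> N \<and> B \<subseteq> N \<and> even (card A) \<and> B \<noteq> A. h A B)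
    + (\<Sum>(A, B) | A \<subseteq> N \<and> B \<subseteq> N \<and> odd (card A) \<and> B \<noteq> A. h A B)"
proof -
  let ?off = "\<lambda>P. {(A, B). A \<subseteq> N \<and> B \<subseteq> N \<and> P (card A) \<and> B \<noteq> A}"
  let ?dia = "\<lambda>P. (\<lambda>A. (A, A)) ` {A. A \<subseteq> N \<and> P (card A)}"
  let ?h = "\<lambda>(A, B). h A B"
  have fin: "finite (?off P)" "finite (?dia P)" for P
    by (rule finite_subset[of _ "Pow N \<times> Pow N"]; use assms in auto)+
  have dia: "sum ?h (?dia P) = (\<Sum>A | A \<subseteq> N \<and> P (card A). h A A)" for P
    by (subst sum.reindex) (auto intro: inj_onI)
  have split: "Pow N \<times> Pow N = ?dia even \<union> ?dia odd \<union> ?off even \<union> ?off odd"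
    by auto
  have disj: "?dia even \<inter> ?dia odd = {}" "(?dia even \<union> ?dia odd) \<inter> ?off even = {}"
      "(?dia even \<union> ?dia odd \<union> ?off even) \<inter> ?off odd = {}"
    by auto
  have "sum ?h (Pow N \<times> Pow N) =
      sum ?h (?dia even) + sum ?h (?dia odd) + sum ?h (?off even) + sum ?h (?off odd)"
    by (simp only: split sum.union_disjoint fin[of even] fin[of odd] disj finite_Un)
  then show ?thesis by (simp only: dia[of even] dia[of odd])
qed

text \<open>The inner index sets are the fibres of symmetric difference, which maps
  \<open>Pow N \<times> Pow N\<close> into \<open>Pow N\<close>, so each pair is counted exactly
  once.\<close>

lemma sum_pairs_group_sym_diff:
  fixes h :: "nat set \<Rightarrow> nat set \<Rightarrow> 'a::comm_monoid_add"
  assumes "finite N"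
  shows "(\<Sum>C\<in>Pow N. \<Sum>(A, B) | A \<subseteq> N \<and> B \<subseteq> N \<and> sym_diff A B = C. h A B) =
    (\<Sum>(A, B)\<in>Pow N \<times> Pow N. h A B)"
proof -
  have "(\<Sum>C\<in>Pow N. \<Sum>p\<in>{p \<in> Pow N \<times> Pow N. (\<lambda>(A, B). sym_diff A B) p = C}. (\<lambda>(A, B). h A B) p) =
      (\<Sum>(A, B)\<in>Pow N \<times> Pow N. h A B)"
    by (rule sum.group) (use assms in auto)
  moreover have "{(A, B). A \<subseteq> N \<and> B \<subseteq> N \<and> sym_diff A B = C} =
      {p \<in> Pow N \<times> Pow N. (\<lambda>(A, B). sym_diff A B) p = C}" for C
    by auto
  ultimately show ?thesis by (simp only:)
qed

theorem proposition3p17: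
  fixes f g :: "'n::finite clifford \<Rightarrow> 'n clifford"
    and U :: "'n clifford set"
    and I :: "'n clifford"
    and J :: "nat \<Rightarrow> 'n clifford"
    and F G :: "nat set \<Rightarrow> complex \<Rightarrow> complex"
  assumes "slice_domain U" and "axially_symmetric U"
    and "slice_monogenic U f" and "slice_monogenic U g"
    and "I \<in> unit_one_vectors"
    and "clifford_frame J" and "J 1 = I"
    and "\<And>A. A \<subseteq> {2..CARD('n)} \<Longrightarrow> F A holomorphic_on {z. slice_emb I z \<in> U}"
    and "\<And>B. B \<subseteq> {2..CARD('n)} \<Longrightarrow> G B holomorphic_on {z. slice_emb I z \<in> U}"
    and "\<And>z. slice_emb I z \<in> U \<Longrightarrow> f (slice_emb I z) = (\<Sum>A\<in>Pow {2..CARD('n)}. slice_emb I (F A z) * blade J A)"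
    and "\<And>z. slice_emb I z \<in> U \<Longrightarrow> g (slice_emb I z) = (\<Sum>B\<in>Pow {2..CARD('n)}. slice_emb I (G B z) * blade J B)"
  shows "\<forall>z. slice_emb I z \<in> U \<longrightarrow>
      (\<Sum>A | A \<subseteq> {2..CARD('n)} \<and> even (card A). (- 1) ^ (card A div 2) * slice_emb I (F A z) * slice_emb I (G A z))
      + (\<Sum>A | A \<subseteq> {2..CARD('n)} \<and> odd (card A). (- 1) ^ ((card A + 1) div 2) * slice_emb I (F A z) * slice_emb I (hat (G A) z))
      + (\<Sum>(A, B) | A \<subseteq> {2..CARD('n)} \<and> B \<subseteq> {2..CARD('n)} \<and> even (card A) \<and> B \<noteq> A.
           slice_emb I (F A z) * slice_emb I (G B z) * blade J A * blade J B)
      + (\<Sum>(A, B) | A \<subseteq> {2..CARD('n)} \<and> B \<subseteq> {2..CARD('n)} \<and> odd (card A) \<and> B \<noteq> A.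
           slice_emb I (F A z) * slice_emb I (hat (G B) z) * blade J A * blade J B)
    = (\<Sum>C\<in>Pow {2..CARD('n)}.
        (\<Sum>(A, B) | A \<subseteq> {2..CARD('n)} \<and> B \<subseteq> {2..CARD('n)} \<and> sym_diff A B = C.
           (- 1) ^ star_sigma A B * slice_emb I (F A z) * (if even (card A) then slice_emb I (G B z) else slice_emb I (hat (G B) z)))
        * blade J C)"
proof (intro allI impI)
  fix z
  let ?N = "{2..CARD('n)}"
  let ?G = "\<lambda>A B. if even (card A) then slice_emb I (G B z) else slice_emb I (hat (G B) z)"
  \<comment> \<open>The coefficient stays to the left of all blades: its I-part need not commute
    with them.\<close>
  define t where "t A B = slice_emb I (F A z) * ?G A B" for A B
  \<comment> \<open>The common summand of both formulas: \<open>h_blades\<close> rewrites it for the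
    off-diagonal sums and \<open>h_diag\<close> for the diagonal ones.\<close>
  define h where "h A B = (- 1) ^ star_sigma A B * t A B * blade J (sym_diff A B)" for A B
  \<comment> \<open>Moving the sign past the coefficient is the only commutation in the
    argument.\<close>
  have sgn_commute: "x * (- 1) ^ k = (- 1) ^ k * x" for x :: "'n clifford" and k
    by (cases "even k") simp_all
  have rel: "clifford_relations CARD('n) J"
    using assms by (simp add: clifford_frame_def)
  have h_blades: "h A B = t A B * blade J A * blade J B" if "A \<subseteq> ?N" "B \<subseteq> ?N" for A B
  proof -
    have "A \<subseteq> {1..CARD('n)}" "B \<subseteq> {1..CARD('n)}" using that by fastforce+
    then have "t A B * blade J A * blade J B =
        t A B * (- 1) ^ star_sigma A B * blade J (sym_diff A B)"
      by (simp only: mult.assoc blade_mult_blade_star_sigma[OF rel])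
    then show ?thesis by (simp only: h_def sgn_commute)
  qed
  have h_diag: "h A A = (if even (card A) then (- 1) ^ (card A div 2)
      else (- 1) ^ ((card A + 1) div 2)) * t A A" if "A \<subseteq> ?N" for A
  proof -
    have "finite A" using that finite_subset by blast
    \<comment> \<open>Here \<open>sym_diff A A\<close> is empty, so the blade is 1 and only sign and
      coefficient remain.\<close>
    then show ?thesis by (simp add: h_def minus_one_power_star_sigma_self)
  qed
  have "(\<Sum>C\<in>Pow ?N. (\<Sum>(A, B) | A \<subseteq> ?N \<and> B \<subseteq> ?N \<and> sym_diff A B = C.
          (- 1) ^ star_sigma A B * slice_emb I (F A z) * ?G A B) * blade J C) =
      (\<Sum>C\<in>Pow ?N. \<Sum>(A, B) | A \<subseteq> ?N \<and> B \<subseteq> ?N \<and> sym_diff A B = C. h A B)"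
    \<comment> \<open>On the fibre over \<open>C\<close> the factor \<open>blade J C\<close> is the
      blade in \<open>h A B\<close>.\<close>
    by (simp only: sum_distrib_right, intro sum.cong refl)
      (auto simp: h_def t_def mult.assoc)
  also have "\<dots> = (\<Sum>(A, B)\<in>Pow ?N \<times> Pow ?N. h A B)"
    by (rule sum_pairs_group_sym_diff) simp
  also have "\<dots> =
      (\<Sum>A | A \<subseteq> ?N \<and> even (card A). h A A) + (\<Sum>A | A \<subseteq> ?N \<and> odd (card A). h A A)
      + (\<Sum>(A, B) | A \<subseteq> ?N \<and> B \<subseteq> ?N \<and> even (card A) \<and> B \<noteq> A. h A B)
      + (\<Sum>(A, B) | A \<subseteq> ?N \<and> B \<subseteq> ?N \<and> odd (card A) \<and> B \<noteq> A. h A B)"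
    by (rule sum_pairs_split_parity_diagonal) simp
  also have "\<dots> =
      (\<Sum>A | A \<subseteq> ?N \<and> even (card A).
        (- 1) ^ (card A div 2) * slice_emb I (F A z) * slice_emb I (G A z))
      + (\<Sum>A | A \<subseteq> ?N \<and> odd (card A).
        (- 1) ^ ((card A + 1) div 2) * slice_emb I (F A z) * slice_emb I (hat (G A) z))
      + (\<Sum>(A, B) | A \<subseteq> ?N \<and> B \<subseteq> ?N \<and> even (card A) \<and> B \<noteq> A.
           slice_emb I (F A z) * slice_emb I (G B z) * blade J A * blade J B)
      + (\<Sum>(A, B) | A \<subseteq> ?N \<and> B \<subseteq> ?N \<and> odd (card A) \<and> B \<noteq> A.
           slice_emb I (F A z) * slice_emb I (hat (G B) z) * blade J A * blade J B)"
    \<comment> \<open>The four sums are matched one by one; the parity condition on each index set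
      resolves the case distinction in \<open>t\<close>.\<close>
    by (intro arg_cong2[where f = "(+)"] sum.cong refl)
      (auto simp: h_diag h_blades t_def mult.assoc)
  finally show "(\<Sum>A | A \<subseteq> ?N \<and> even (card A). (- 1) ^ (card A div 2) * slice_emb I (F A z) * slice_emb I (G A z))
        + (\<Sum>A | A \<subseteq> ?N \<and> odd (card A). (- 1) ^ ((card A + 1) div 2) * slice_emb I (F A z) * slice_emb I (hat (G A) z))
        + (\<Sum>(A, B) | A \<subseteq> ?N \<and> B \<subseteq> ?N \<and> even (card A) \<and> B \<noteq> A.
             slice_emb I (F A z) * slice_emb I (G B z) * blade J A * blade J B)
        + (\<Sum>(A, B) | A \<subseteq> ?N \<and> B \<subseteq> ?N \<and> odd (card A) \<and> B \<noteq> A.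
             slice_emb I (F A z) * slice_emb I (hat (G B) z) * blade J A * blade J B)
      = (\<Sum>C\<in>Pow ?N.
          (\<Sum>(A, B) | A \<subseteq> ?N \<and> B \<subseteq> ?N \<and> sym_diff A B = C.
             (- 1) ^ star_sigma A B * slice_emb I (F A z) * (if even (card A) then slice_emb I (G B z) else slice_emb I (hat (G B) z)))
          * blade J C)"
    by (rule sym)
qed

end
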